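(* Let $F:\mathbb{R}^d\to\mathbb{R}$ be $L$-smooth with a global minimizer $x^*$, and assume that $F$ satisfies the gradient domination (Lojasiewicz) condition with constant $\mu>0$: $$F(x)-\min F\le\frac{1}{2\mu}\|\nabla F(x)\|^2\qquad\text{for all }x\in\mathbb{R}^d.$$ Let $x_0\in\mathbb{R}^d$, $h>0$, $K\ge1$, and let $$x_{k+1}=x_k-hg_k,\qquad k=0,\dots,K-1,$$ where $(g_k)_{k=0}^{K-1}$ is a MARINA estimator of the gradient along $(x_k)$ with parameters $0<p\le1$ and $\alpha,\theta\ge0$. If $$0<h\le\min\left\{\frac{1}{14L}\sqrt{\frac{p}{1+\alpha}},\ \frac{p}{6\mu}\right\},$$ then $$\mathbb{E}[F(x_K)]-F(x^* )\le e^{-\mu Kh}\left(\Psi_2-F(x^* )\right)+\frac{1-e^{-K\mu h}}{\mu}C\theta,$$ where $\Psi_2=F(x_0)+\frac{1-e^{-\mu h}}{\mu}C\,\mathbf G_0$, $\mathbf G_0=\mathbb{E}\left[\|g_0-\nabla F(x_0)\|^2\right]$ and $$C=\frac{8L^2h^2\beta+2\beta}{1-(1-p)(4L^2h^2\alpha+1)\beta},\qquad\beta=e^{\mu h}.$$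
   Context: $F$ is $L$-smooth ($L>0$): $F$ is differentiable and $\|\nabla F(x)-\nabla F(y)\|\le L\|x-y\|$ for all $x,y$. $F$ need not be convex. The starting point $x_0$ is deterministic; the $g_k$ are random. MARINA estimator: given a random sequence $(x_k)_k$ in $\mathbb{R}^d$ produced by an algorithm, a random sequence $(g_k)_k$ in $\mathbb{R}^d$ is a MARINA estimator of the gradient with parameters $0<p\le1$, $\alpha,\theta\ge0$ if $\mathbb{E}[g_k]=\mathbb{E}[\nabla F(x_k)]$ for all $k$ and, with $\mathbf G_k=\mathbb{E}\left[\|g_k-\nabla F(x_k)\|^2\right]$, $$\mathbf G_{k+1}\le(1-p)\mathbf G_k+(1-p)L^2\alpha\,\mathbb{E}\left[\|x_{k+1}-x_k\|^2\right]+\theta$$ for all indices $k$ for which $g_k$ and $g_{k+1}$ are both defined. *)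

theory Defs
  imports "HOL-Probability.Probability"
begin

definition gradient :: "('a::euclidean_space \<Rightarrow> real) \<Rightarrow> 'a \<Rightarrow> 'a" where
  "gradient F x = (THE D. GDERIV F x :> D)"

lemma GDERIV_gradient:
  fixes F :: "'a::euclidean_space \<Rightarrow> real"
  assumes "F differentiable (at x)"
  shows "GDERIV F x :> gradient F x"
proof -
  obtain F' where F': "(F has_derivative F') (at x)"
    using assms by (auto simp: differentiable_def)
  then interpret linear F' by (rule has_derivative_linear)
  have "F' = (\<lambda>v. inner v (\<Sum>b\<in>Basis. F' b *\<^sub>R b))"
  proof
    fix v
    have "F' v = F' (\<Sum>b\<in>Basis. inner v b *\<^sub>R b)"
      by (simp add: euclidean_representation)
    also have "\<dots> = inner v (\<Sum>b\<in>Basis. F' b *\<^sub>R b)"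
      by (simp add: sum scale inner_sum_right mult.commute)
    finally show "F' v = inner v (\<Sum>b\<in>Basis. F' b *\<^sub>R b)" .
  qed
  then have ex: "GDERIV F x :> (\<Sum>b\<in>Basis. F' b *\<^sub>R b)"
    using F' by (simp add: gderiv_def)
  have unique: "D = D'" if "GDERIV F x :> D" "GDERIV F x :> D'" for D D'
  proof -
    have "(\<lambda>v. inner v D) = (\<lambda>v. inner v D')"
      using that unfolding gderiv_def by (rule has_derivative_unique)
    then show ?thesis by (metis vector_eq_ldot)
  qed
  show ?thesis
    unfolding gradient_def by (rule theI[where P = "\<lambda>D. GDERIV F x :> D", OF ex unique[OF _ ex]])
qed

definition L_smooth :: "real \<Rightarrow> ('a::euclidean_space \<Rightarrow> real) \<Rightarrow> bool" where
  "L_smooth L F \<longleftrightarrow>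
     0 < L \<and> (\<forall>x. F differentiable (at x)) \<and>
     (\<forall>x y. norm (gradient F x - gradient F y) \<le> L * norm (x - y))"

definition grad_err ::
  "'w measure \<Rightarrow> ('a::euclidean_space \<Rightarrow> real) \<Rightarrow> (nat \<Rightarrow> 'w \<Rightarrow> 'a) \<Rightarrow> (nat \<Rightarrow> 'w \<Rightarrow> 'a) \<Rightarrow> nat \<Rightarrow> real"
where
  "grad_err M F x g k = (\<integral>\<omega>. (norm (g k \<omega> - gradient F (x k \<omega>)))\<^sup>2 \<partial>M)"

text \<open>
  The estimator is the finite sequence \<open>g 0, \<dots>, g (K - 1)\<close>; later values of \<open>g\<close> are
  irrelevant, and the recursion relates \<open>g k\<close> and \<open>g (k + 1)\<close> only when both have index below
  \<open>K\<close>. The Bochner integral of a non-integrable function is 0, so the existence and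
  finiteness of every expectation that occurs is required explicitly.
\<close>

definition marina_estimator ::
  "'w measure \<Rightarrow> ('a::euclidean_space \<Rightarrow> real) \<Rightarrow> real \<Rightarrow> real \<Rightarrow> real \<Rightarrow> real \<Rightarrow> nat \<Rightarrow>
   (nat \<Rightarrow> 'w \<Rightarrow> 'a) \<Rightarrow> (nat \<Rightarrow> 'w \<Rightarrow> 'a) \<Rightarrow> bool"
where
  "marina_estimator M F L p \<alpha> \<theta> K x g \<longleftrightarrow>
     0 < p \<and> p \<le> 1 \<and> 0 \<le> \<alpha> \<and> 0 \<le> \<theta> \<and>
     (\<forall>k<K. x k \<in> borel_measurable M \<and> g k \<in> borel_measurable M \<and>
        integrable M (g k) \<and>
        integrable M (\<lambda>\<omega>. gradient F (x k \<omega>)) \<and>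
        integrable M (\<lambda>\<omega>. (norm (g k \<omega> - gradient F (x k \<omega>)))\<^sup>2) \<and>
        (\<integral>\<omega>. g k \<omega> \<partial>M) = (\<integral>\<omega>. gradient F (x k \<omega>) \<partial>M)) \<and>
     (\<forall>k. k + 1 < K \<longrightarrow>
        integrable M (\<lambda>\<omega>. (norm (x (k + 1) \<omega> - x k \<omega>))\<^sup>2) \<and>
        grad_err M F x g (k + 1) \<le>
          (1 - p) * grad_err M F x g k
          + (1 - p) * L\<^sup>2 * \<alpha> * (\<integral>\<omega>. (norm (x (k + 1) \<omega> - x k \<omega>))\<^sup>2 \<partial>M)
          + \<theta>)"

end

theory Submission
  imports Defs
begin

text \<open>
  Along the segment \<open>x - t g\<close>, \<open>0 \<le> t \<le> h\<close>, gradient domination and the polarization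
  identity for \<open>\<nabla>F \<bullet> g\<close> give a Gronwall inequality for \<open>F - F(x\<^sup>*)\<close>. It bounds one step
  pathwise with the factor \<open>a = (1 - exp (- \<mu> h)) / \<mu>\<close> in front of the squared gradient error,
  and leaves a negative multiple of \<open>\<parallel>g\<parallel>\<^sup>2\<close>. After taking expectations, the Lyapunov function
  \<open>E F(x\<^sub>k) - F(x\<^sup>*) + a C G\<^sub>k\<close> contracts by \<open>exp (- \<mu> h)\<close> up to \<open>a C \<theta>\<close>: the step size bound makes
  that negative term absorb the term with \<open>\<parallel>x\<^sub>k\<^sub>+\<^sub>1 - x\<^sub>k\<parallel>\<^sup>2 = h\<^sup>2 \<parallel>g\<^sub>k\<parallel>\<^sup>2\<close> of the estimator.
  The last step is treated separately, since \<open>G\<^sub>K\<close> is not defined.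
\<close>

lemma norm_diff_sq_le:
  fixes a b c :: "'a::real_normed_vector"
  shows "(norm (a - c))\<^sup>2 \<le> 2 * (norm (a - b))\<^sup>2 + 2 * (norm (b - c))\<^sup>2"
proof -
  have "norm (a - c) \<le> norm (a - b) + norm (b - c)"
    using norm_triangle_ineq[of "a - b" "b - c"] by simp
  then have "(norm (a - c))\<^sup>2 \<le> (norm (a - b) + norm (b - c))\<^sup>2"
    by (simp add: power_mono)
  also have "\<dots> \<le> 2 * (norm (a - b))\<^sup>2 + 2 * (norm (b - c))\<^sup>2"
    using sum_squares_bound[of "norm (a - b)" "norm (b - c)"] by (simp add: power2_sum)
  finally show ?thesis .
qed

text \<open>With \<open>u t = F (x - t *\<^sub>R v) - Fmin\<close>, gradient domination and
  smoothness give u' \<le> - \<mu> u + \<open>B\<close> on [0, h], where \<open>B\<close> does not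
  depend on t. Integrating this differential inequality over [0, h] yields the bound.\<close>

lemma gradient_step_le:
  fixes F :: "'a::euclidean_space \<Rightarrow> real"
  assumes smooth: "L_smooth L F"
    and \<mu>: "0 < \<mu>"
    and dom: "\<And>y. F y - Fmin \<le> 1 / (2 * \<mu>) * (norm (gradient F y))\<^sup>2"
    and h: "0 \<le> h"
  shows "F (x - h *\<^sub>R v) - Fmin \<le> exp (- \<mu> * h) * (F x - Fmin)
    + (1 - exp (- \<mu> * h)) / \<mu> * ((norm (v - gradient F x))\<^sup>2 + (L\<^sup>2 * h\<^sup>2 - 1 / 2) * (norm v)\<^sup>2)"
proof -
  define B where "B = (norm (v - gradient F x))\<^sup>2 + (L\<^sup>2 * h\<^sup>2 - 1 / 2) * (norm v)\<^sup>2"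
  \<comment> \<open>The subtracted term is the integral of \<open>exp (\<mu> * s) * B\<close> over
    [0, t]. With the integrating factor \<open>exp (\<mu> * t)\<close>, the differential inequality
    for u says exactly that \<open>\<phi>\<close> is nonincreasing.\<close>
  define \<phi> where "\<phi> t = exp (\<mu> * t) * (F (x - t *\<^sub>R v) - Fmin) - (exp (\<mu> * t) - 1) / \<mu> * B" for t
  have L: "0 < L" using smooth by (simp add: L_smooth_def)
  have F': "((\<lambda>t. F (x - t *\<^sub>R v)) has_real_derivative - (gradient F (x - t *\<^sub>R v) \<bullet> v)) (at t)" for t
  proof -
    have "(F has_derivative (\<lambda>u. u \<bullet> gradient F (x - t *\<^sub>R v))) (at (x - t *\<^sub>R v))"
      using smooth GDERIV_gradient by (auto simp: L_smooth_def gderiv_def)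
    moreover have "((\<lambda>t. x - t *\<^sub>R v) has_derivative (\<lambda>s. - (s *\<^sub>R v))) (at t)"
      by (auto intro!: derivative_eq_intros)
    ultimately have "((\<lambda>t. F (x - t *\<^sub>R v)) has_derivative
        (\<lambda>s. - (s *\<^sub>R v) \<bullet> gradient F (x - t *\<^sub>R v))) (at t)"
      by (rule has_derivative_compose[rotated])
    then show ?thesis
      by (rule has_derivative_imp_has_field_derivative) (simp add: inner_commute mult.commute)
  qed
  have \<phi>': "(\<phi> has_real_derivative
      exp (\<mu> * t) * (\<mu> * (F (x - t *\<^sub>R v) - Fmin) - gradient F (x - t *\<^sub>R v) \<bullet> v - B)) (at t)" for t
    unfolding \<phi>_def using \<mu>
    by (auto intro!: derivative_eq_intros F' simp: algebra_simps)
  \<comment> \<open>With G the gradient at the moving point, domination bounds the first term by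
    norm(G)^2 / 2. Polarization of the inner product then cancels norm(G)^2 and leaves (norm(G -
    v)^2 - norm(v)^2) / 2. Splitting G - v at \<open>gradient F x\<close> produces the estimator
    error and a drift of at most L h norm(v).\<close>
  have "\<mu> * (F (x - t *\<^sub>R v) - Fmin) - gradient F (x - t *\<^sub>R v) \<bullet> v - B \<le> 0"
    if t: "0 \<le> t" "t \<le> h" for t
  proof -
    let ?G = "gradient F (x - t *\<^sub>R v)"
    have "\<mu> * (F (x - t *\<^sub>R v) - Fmin) \<le> (norm ?G)\<^sup>2 / 2"
      using mult_left_mono[OF dom[of "x - t *\<^sub>R v"], of \<mu>] \<mu> by simp
    moreover have "(norm (?G - v))\<^sup>2 = (norm ?G)\<^sup>2 + (norm v)\<^sup>2 - 2 * (?G \<bullet> v)"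
      by (simp add: power2_norm_eq_inner inner_diff_left inner_diff_right inner_commute)
    moreover have "(norm (?G - v))\<^sup>2 \<le> 2 * (norm (?G - gradient F x))\<^sup>2
        + 2 * (norm (v - gradient F x))\<^sup>2"
      using norm_diff_sq_le[of ?G v "gradient F x"] by (simp add: norm_minus_commute)
    moreover have "(norm (?G - gradient F x))\<^sup>2 \<le> L\<^sup>2 * h\<^sup>2 * (norm v)\<^sup>2"
    proof -
      have "norm (?G - gradient F x) \<le> L * norm (x - t *\<^sub>R v - x)"
        using smooth by (simp only: L_smooth_def)
      also have "\<dots> = L * (t * norm v)" using t by simp
      also have "\<dots> \<le> L * (h * norm v)"
        using t L by (intro mult_left_mono mult_right_mono) auto
      finally have "(norm (?G - gradient F x))\<^sup>2 \<le> (L * (h * norm v))\<^sup>2"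
        by (rule power_mono) simp
      then show ?thesis by (simp add: power_mult_distrib mult.assoc)
    qed
    ultimately show ?thesis unfolding B_def left_diff_distrib by linarith
  qed
  then have "\<exists>y. (\<phi> has_real_derivative y) (at t) \<and> y \<le> 0" if "0 \<le> t" "t \<le> h" for t
    using \<phi>'[of t] that by (intro exI conjI) (assumption, simp add: mult_nonneg_nonpos)
  then have "\<phi> h \<le> \<phi> 0"
    by (intro DERIV_nonpos_imp_nonincreasing[OF h]) auto
  then have "exp (\<mu> * h) * (F (x - h *\<^sub>R v) - Fmin) \<le> F x - Fmin + (exp (\<mu> * h) - 1) / \<mu> * B"
    by (simp add: \<phi>_def)
  from mult_left_mono[OF this exp_ge_zero[of "- \<mu> * h"]]
  have "exp (- \<mu> * h) * exp (\<mu> * h) * (F (x - h *\<^sub>R v) - Fmin)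
      \<le> exp (- \<mu> * h) * (F x - Fmin)
        + (exp (- \<mu> * h) * exp (\<mu> * h) - exp (- \<mu> * h)) / \<mu> * B"
    by (simp only: distrib_left right_diff_distrib mult.assoc times_divide_eq_right
        times_divide_eq_left mult_1_left left_diff_distrib diff_divide_distrib)
  moreover have "exp (- \<mu> * h) * exp (\<mu> * h) = 1"
    by (simp flip: exp_add)
  ultimately show ?thesis
    unfolding B_def[symmetric] by simp
qed

text \<open>These are the numerical facts behind the recursion: the first keeps a negative multiple
  of the squared step, the second serves the final step, the third contracts the gradient error, and
  the fourth absorbs the increment of the iterates. All follow from rewriting \<open>C\<close> as (8
  u + 2) / D with D at least a multiple of p.\<close>

lemma marina_constant_bounds:
  fixes L \<mu> h p \<alpha> :: real
  assumes "0 < L" "0 < \<mu>" "0 < p" "p \<le> 1" "0 \<le> \<alpha>" "0 < h"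
    and h: "h \<le> min (1 / (14 * L) * sqrt (p / (1 + \<alpha>))) (p / (6 * \<mu>))"
    and \<beta>: "\<beta> = exp (\<mu> * h)"
    and C: "C = (8 * L\<^sup>2 * h\<^sup>2 * \<beta> + 2 * \<beta>) / (1 - (1 - p) * (4 * L\<^sup>2 * h\<^sup>2 * \<alpha> + 1) * \<beta>)"
  shows "L\<^sup>2 * h\<^sup>2 \<le> 1 / 196"
    and "1 \<le> C * exp (- \<mu> * h)"
    and "1 + C * (1 - p) \<le> C * exp (- \<mu> * h)"
    and "C * ((1 - p) * L\<^sup>2 * \<alpha> * h\<^sup>2) \<le> 1 / 4"
proof -
  define u where "u = L\<^sup>2 * h\<^sup>2"
  define e where "e = exp (- \<mu> * h)"
  have "14 * L * h \<le> sqrt (p / (1 + \<alpha>))"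
    using h \<open>0 < L\<close> by (simp add: field_simps)
  then have "(14 * L * h)\<^sup>2 \<le> p / (1 + \<alpha>)"
    using assms real_sqrt_le_iff[of "(14 * L * h)\<^sup>2"] by (simp add: real_le_rsqrt sqrt_ge_absD)
  \<comment> \<open>Here 196 = 14^2; the factor 1 + \<alpha> makes both u and u \<alpha> at most p /
    196.\<close>
  then have u: "196 * u * (1 + \<alpha>) \<le> p"
    using \<open>0 \<le> \<alpha>\<close> by (simp add: u_def power_mult_distrib field_simps)
  have u0: "0 \<le> u" by (simp add: u_def)
  have "0 \<le> u * \<alpha>" using u0 \<open>0 \<le> \<alpha>\<close> by simp
  with u u0 have ub: "196 * u \<le> p" "196 * (u * \<alpha>) \<le> p" by (auto simp: algebra_simps)
  show "L\<^sup>2 * h\<^sup>2 \<le> 1 / 196" using ub \<open>p \<le> 1\<close> by (simp add: u_def)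
  have "\<mu> * h \<le> p / 6" using h \<open>0 < \<mu>\<close> by (simp add: field_simps)
  then have e: "1 - p / 6 \<le> e" using exp_ge_add_one_self[of "- \<mu> * h"] by (simp add: e_def)
  have \<beta>e: "\<beta> = 1 / e" "0 < e" by (auto simp: \<beta> e_def exp_minus field_simps)
  \<comment> \<open>\<open>D\<close> is the denominator of \<open>C\<close> times \<open>e\<close>.
    From e \<ge> 1 - p/6 and 4 u \<alpha> \<le> 4 p / 196 it is at least p (1 - 1/6 - 4/196), which
    exceeds 8/10 p, so the denominator of \<open>C\<close> is positive.\<close>
  define D where "D = e - (1 - p) * (4 * (u * \<alpha>) + 1)"
  have "(1 - p) * (4 * (u * \<alpha>)) \<le> 1 * (4 * (u * \<alpha>))"
    using assms \<open>0 \<le> u * \<alpha>\<close> by (intro mult_right_mono) auto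
  moreover have "D = e - (1 - p) - (1 - p) * (4 * (u * \<alpha>))" by (simp add: D_def algebra_simps)
  ultimately have D: "8 / 10 * p \<le> D" using e ub \<open>0 < p\<close> by linarith
  with \<open>0 < p\<close> have D0: "0 < D" by simp
  have "1 - (1 - p) * (4 * L\<^sup>2 * h\<^sup>2 * \<alpha> + 1) * \<beta> = D / e"
    unfolding \<beta>e(1) using \<beta>e(2) by (simp add: u_def D_def diff_divide_distrib mult_ac)
  moreover have "8 * L\<^sup>2 * h\<^sup>2 * \<beta> + 2 * \<beta> = (8 * u + 2) / e"
    unfolding \<beta>e(1) by (simp add: u_def add_divide_distrib mult_ac)
  ultimately have "C = ((8 * u + 2) / e) / (D / e)"
    by (simp only: C)
  then have C_eq: "C = (8 * u + 2) / D" using \<beta>e(2) by simp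
  from C_eq have CD: "C * D = 8 * u + 2" and C0: "0 \<le> C"
    using D0 u0 by auto
  have q: "0 \<le> (1 - p) * (4 * (u * \<alpha>))" using assms \<open>0 \<le> u * \<alpha>\<close> by simp
  \<comment> \<open>The numerator of \<open>C\<close> enters here: \<open>C * D = 8 * u + 2\<close>
    is at least 1, which pays for the summand 1 in the third bound.\<close>
  have *: "C * e - C * (1 - p) = C * D + C * ((1 - p) * (4 * (u * \<alpha>)))"
    by (simp add: D_def algebra_simps)
  with CD u0 mult_nonneg_nonneg[OF C0 q] show 1: "1 + C * (1 - p) \<le> C * exp (- \<mu> * h)"
    unfolding e_def by linarith
  have "0 \<le> C * (1 - p)" using C0 \<open>p \<le> 1\<close> by simp
  with 1 show "1 \<le> C * exp (- \<mu> * h)" by linarith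
  \<comment> \<open>Although \<open>C\<close> may grow like 1 / p, the product \<open>C * p\<close>
    stays bounded, and u \<alpha> is of order p; this gives the fourth bound.\<close>
  have "C * (8 / 10 * p) \<le> 8 * u + 2" using mult_left_mono[OF D C0] CD by simp
  then have Cp: "C * p \<le> 3" using ub \<open>p \<le> 1\<close> by simp
  have "(1 - p) * (u * \<alpha>) \<le> 1 * (u * \<alpha>)"
    using assms \<open>0 \<le> u * \<alpha>\<close> by (intro mult_right_mono) auto
  with ub have "(1 - p) * (u * \<alpha>) \<le> p / 196" by simp
  from mult_left_mono[OF this C0] Cp have "C * ((1 - p) * (u * \<alpha>)) \<le> 1 / 4" by simp
  then show "C * ((1 - p) * L\<^sup>2 * \<alpha> * h\<^sup>2) \<le> 1 / 4" by (simp add: u_def mult_ac)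
qed

text \<open>The conclusion includes integrability of the final objective value: a Bochner integral
  defaults to 0 otherwise, and the inequality alone would not concern an expectation.\<close>

theorem theorem3:
  fixes M :: "'w measure"
    and F :: "real ^ 'd \<Rightarrow> real"
    and x g :: "nat \<Rightarrow> 'w \<Rightarrow> real ^ 'd"
    and x0 xstar :: "real ^ 'd"
    and L \<mu> h p \<alpha> \<theta> \<beta> C \<Psi>\<^sub>2 :: real
    and K :: nat
  assumes "prob_space M"
    and "L_smooth L F"
    and "\<forall>y. F xstar \<le> F y"
    and "0 < \<mu>"
    and "\<forall>y. F y - F xstar \<le> 1 / (2 * \<mu>) * (norm (gradient F y))\<^sup>2"
    and "1 \<le> K"
    and "\<forall>\<omega>\<in>space M. x 0 \<omega> = x0"
    and "\<forall>k<K. \<forall>\<omega>\<in>space M. x (k + 1) \<omega> = x k \<omega> - h *\<^sub>R g k \<omega>"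
    and "marina_estimator M F L p \<alpha> \<theta> K x g"
    and "0 < h"
    and "h \<le> min (1 / (14 * L) * sqrt (p / (1 + \<alpha>))) (p / (6 * \<mu>))"
    and "\<beta> = exp (\<mu> * h)"
    and "C = (8 * L\<^sup>2 * h\<^sup>2 * \<beta> + 2 * \<beta>) / (1 - (1 - p) * (4 * L\<^sup>2 * h\<^sup>2 * \<alpha> + 1) * \<beta>)"
    and "\<Psi>\<^sub>2 = F x0 + (1 - exp (- \<mu> * h)) / \<mu> * C * grad_err M F x g 0"
  shows "integrable M (\<lambda>\<omega>. F (x K \<omega>)) \<and>
    (\<integral>\<omega>. F (x K \<omega>) \<partial>M) - F xstar
      \<le> exp (- \<mu> * real K * h) * (\<Psi>\<^sub>2 - F xstar)
        + (1 - exp (- real K * \<mu> * h)) / \<mu> * C * \<theta>"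
proof -
  interpret prob_space M by fact
  note smooth = assms(2) and Fmin = assms(3) and \<mu> = assms(4) and dom = assms(5)
    and step = assms(8) and marina = assms(9) and h = assms(10)
  have p: "0 < p" "p \<le> 1" "0 \<le> \<alpha>" "0 \<le> \<theta>"
    using marina by (auto simp: marina_estimator_def)
  have L: "0 < L" using smooth by (simp add: L_smooth_def)
  note bounds = marina_constant_bounds[OF L \<mu> p(1-3) h assms(11-13)]
  define e where "e = exp (- \<mu> * h)"
  define a where "a = (1 - e) / \<mu>"
  define f where "f k = (\<integral>\<omega>. F (x k \<omega>) \<partial>M) - F xstar" for k
  define G where "G k = grad_err M F x g k" for k
  define N where "N k = (\<integral>\<omega>. (norm (g k \<omega>))\<^sup>2 \<partial>M)" for k
  have e: "0 < e" "e < 1" using \<mu> h by (auto simp: e_def)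
  have a: "0 < a" using e \<mu> by (simp add: a_def)
  have C0: "0 \<le> C"
    using bounds(2) zero_less_mult_pos2[of C "exp (- \<mu> * h)"] by fastforce

  \<comment> \<open>Measurability and the pathwise descent bound\<close>
  have x_step: "x (k + 1) \<omega> = x k \<omega> - h *\<^sub>R g k \<omega>" if "k < K" "\<omega> \<in> space M" for k \<omega>
    using step that by blast
  have x_meas: "x k \<in> borel_measurable M" if "k \<le> K" for k
  proof (cases "k < K")
    case True
    then show ?thesis using marina by (simp add: marina_estimator_def)
  next
    \<comment> \<open>The estimator provides measurability only below \<open>K\<close>; for
      \<open>x K\<close> it comes from the update rule.\<close>
    case False
    with that \<open>1 \<le> K\<close> obtain j where j: "k = j + 1" "j < K"
      by (metis add.commute le_add_diff_inverse le_neq_implies_less less_add_one)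
    then have "(\<lambda>\<omega>. x j \<omega> - h *\<^sub>R g j \<omega>) \<in> borel_measurable M"
      using marina by (auto simp: marina_estimator_def)
    then show ?thesis
      using measurable_cong[of M "x k" "\<lambda>\<omega>. x j \<omega> - h *\<^sub>R g j \<omega>"] x_step j by auto
  qed
  have g_meas: "g k \<in> borel_measurable M" if "k < K" for k
    using marina that by (simp add: marina_estimator_def)
  have err_int: "integrable M (\<lambda>\<omega>. (norm (g k \<omega> - gradient F (x k \<omega>)))\<^sup>2)" if "k < K" for k
    using marina that by (simp add: marina_estimator_def)
  have "continuous_on UNIV F"
    using smooth by (auto simp: L_smooth_def continuous_on_eq_continuous_at
        intro: differentiable_imp_continuous_within)
  then have F_meas: "(\<lambda>\<omega>. F (x k \<omega>)) \<in> borel_measurable M" if "k \<le> K" for k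
    using measurable_compose[OF x_meas[OF that]] borel_measurable_continuous_onI by blast
  have path: "F (x (k + 1) \<omega>) - F xstar + a / 4 * (norm (g k \<omega>))\<^sup>2
      \<le> e * (F (x k \<omega>) - F xstar) + a * (norm (g k \<omega> - gradient F (x k \<omega>)))\<^sup>2"
    if k: "k < K" "\<omega> \<in> space M" for k \<omega>
  proof -
    have "F (x (k + 1) \<omega>) - F xstar \<le> e * (F (x k \<omega>) - F xstar)
        + a * ((norm (g k \<omega> - gradient F (x k \<omega>)))\<^sup>2 + (L\<^sup>2 * h\<^sup>2 - 1 / 2) * (norm (g k \<omega>))\<^sup>2)"
      using gradient_step_le[OF smooth \<mu>, of "F xstar" h "x k \<omega>" "g k \<omega>"] dom h x_step[OF k]
      by (simp add: e_def a_def)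
    also have "\<dots> \<le> e * (F (x k \<omega>) - F xstar)
        + a * ((norm (g k \<omega> - gradient F (x k \<omega>)))\<^sup>2 + (- 1 / 4) * (norm (g k \<omega>))\<^sup>2)"
      using a bounds(1) by (intro add_left_mono mult_left_mono mult_right_mono) auto
    finally show ?thesis by (simp add: algebra_simps)
  qed

  \<comment> \<open>Integrability along the iteration\<close>
  have int_step: "integrable M (\<lambda>\<omega>. F (x (k + 1) \<omega>))" "integrable M (\<lambda>\<omega>. (norm (g k \<omega>))\<^sup>2)"
    if k: "k < K" and int: "integrable M (\<lambda>\<omega>. F (x k \<omega>))" for k
  proof -
    \<comment> \<open>Both terms on the left of the pathwise bound are nonnegative, the first
      because \<open>xstar\<close> is a minimizer. Hence each is dominated separately by the
      integrable right-hand side \<open>?r\<close>.\<close>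
    let ?r = "\<lambda>\<omega>. e * (F (x k \<omega>) - F xstar) + a * (norm (g k \<omega> - gradient F (x k \<omega>)))\<^sup>2"
    have r: "integrable M ?r" using int err_int[OF k] by auto
    have "integrable M (\<lambda>\<omega>. F (x (k + 1) \<omega>) - F xstar)"
    proof (rule Bochner_Integration.integrable_bound[OF r])
      show "AE \<omega> in M. norm (F (x (k + 1) \<omega>) - F xstar) \<le> norm (?r \<omega>)"
      proof (rule AE_I2)
        fix \<omega> assume "\<omega> \<in> space M"
        moreover have "0 \<le> a / 4 * (norm (g k \<omega>))\<^sup>2" using a by simp
        moreover have "F xstar \<le> F (x (k + 1) \<omega>)" using Fmin by blast
        ultimately show "norm (F (x (k + 1) \<omega>) - F xstar) \<le> norm (?r \<omega>)"
          using path[OF k, of \<omega>] unfolding real_norm_def by linarith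
      qed
    qed (use F_meas[of "k + 1"] k in auto)
    then have "integrable M (\<lambda>\<omega>. F (x (k + 1) \<omega>) - F xstar + F xstar)"
      by (rule Bochner_Integration.integrable_add) simp
    then show "integrable M (\<lambda>\<omega>. F (x (k + 1) \<omega>))" by simp
    have "integrable M (\<lambda>\<omega>. a / 4 * (norm (g k \<omega>))\<^sup>2)"
    proof (rule Bochner_Integration.integrable_bound[OF r])
      show "AE \<omega> in M. norm (a / 4 * (norm (g k \<omega>))\<^sup>2) \<le> norm (?r \<omega>)"
      proof (rule AE_I2)
        fix \<omega> assume "\<omega> \<in> space M"
        moreover have "0 \<le> a / 4 * (norm (g k \<omega>))\<^sup>2" using a by simp
        moreover have "F xstar \<le> F (x (k + 1) \<omega>)" using Fmin by blast
        ultimately show "norm (a / 4 * (norm (g k \<omega>))\<^sup>2) \<le> norm (?r \<omega>)"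
          using path[OF k, of \<omega>] unfolding real_norm_def by linarith
      qed
    qed (use g_meas[OF k] in measurable)
    then have "integrable M (\<lambda>\<omega>. 4 / a * (a / 4 * (norm (g k \<omega>))\<^sup>2))"
      by (rule integrable_mult_right)
    then show "integrable M (\<lambda>\<omega>. (norm (g k \<omega>))\<^sup>2)" using a by simp
  qed
  have f0: "integrable M (\<lambda>\<omega>. F (x 0 \<omega>))" "f 0 = F x0 - F xstar"
  proof -
    have "integrable M (\<lambda>\<omega>. F (x 0 \<omega>)) = integrable M (\<lambda>_. F x0)"
      using assms(7) by (intro Bochner_Integration.integrable_cong) auto
    then show "integrable M (\<lambda>\<omega>. F (x 0 \<omega>))" by simp
    have "(\<integral>\<omega>. F (x 0 \<omega>) \<partial>M) = (\<integral>_. F x0 \<partial>M)"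
      using assms(7) by (intro Bochner_Integration.integral_cong) auto
    then show "f 0 = F x0 - F xstar" by (simp add: f_def prob_space)
  qed
  have F_int: "integrable M (\<lambda>\<omega>. F (x k \<omega>))" if "k \<le> K" for k
    using that by (induction k) (use f0 int_step in auto)

  \<comment> \<open>Recursions in expectation\<close>
  have f_step: "f (k + 1) + a / 4 * N k \<le> e * f k + a * G k" if k: "k < K" for k
  proof -
    have "integrable M (\<lambda>\<omega>. F (x k \<omega>))" "integrable M (\<lambda>\<omega>. F (x (k + 1) \<omega>))"
      using F_int[of k] F_int[of "k + 1"] k by auto
    moreover note int_step(2)[OF k this(1)] err_int[OF k]
    moreover from calculation have
      "(\<integral>\<omega>. F (x (k + 1) \<omega>) - F xstar + a / 4 * (norm (g k \<omega>))\<^sup>2 \<partial>M)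
        \<le> (\<integral>\<omega>. e * (F (x k \<omega>) - F xstar) + a * (norm (g k \<omega> - gradient F (x k \<omega>)))\<^sup>2 \<partial>M)"
      using path[OF k] by (intro integral_mono) auto
    ultimately show ?thesis
      by (simp add: f_def N_def G_def grad_err_def prob_space)
  qed
  have N0: "0 \<le> N k" and G0: "0 \<le> G k" for k by (simp_all add: N_def G_def grad_err_def)
  have G_step: "G (k + 1) \<le> (1 - p) * G k + (1 - p) * L\<^sup>2 * \<alpha> * h\<^sup>2 * N k + \<theta>" if k: "k + 1 < K" for k
  proof -
    have "(\<integral>\<omega>. (norm (x (k + 1) \<omega> - x k \<omega>))\<^sup>2 \<partial>M) = (\<integral>\<omega>. h\<^sup>2 * (norm (g k \<omega>))\<^sup>2 \<partial>M)"
      using x_step[of k] k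
      by (intro Bochner_Integration.integral_cong) (auto simp: power_mult_distrib)
    then show ?thesis
      using marina k by (auto simp: marina_estimator_def N_def G_def)
  qed
  \<comment> \<open>Add \<open>a * C\<close> times the estimator recursion to the descent bound: the
    \<open>N k\<close> terms cancel by the fourth constant bound, and the third bounds the total
    coefficient of \<open>G k\<close> by \<open>e * a * C\<close>.\<close>
  have V_step: "f (k + 1) + a * C * G (k + 1) \<le> e * (f k + a * C * G k) + a * C * \<theta>"
    if k: "k + 1 < K" for k
  proof -
    have "a * C * G (k + 1)
        \<le> a * C * ((1 - p) * G k + (1 - p) * L\<^sup>2 * \<alpha> * h\<^sup>2 * N k + \<theta>)"
      using G_step[OF k] a C0 by (intro mult_left_mono) auto
    moreover have "a * (C * ((1 - p) * L\<^sup>2 * \<alpha> * h\<^sup>2)) * N k \<le> a * (1 / 4) * N k"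
      using bounds(4) a N0 by (intro mult_left_mono mult_right_mono) auto
    moreover have "a * (1 + C * (1 - p)) * G k \<le> a * (C * e) * G k"
      using bounds(3) a G0 by (intro mult_left_mono mult_right_mono) (auto simp: e_def)
    moreover have "f (k + 1) + a / 4 * N k \<le> e * f k + a * G k" using f_step k by simp
    ultimately show ?thesis by (simp add: algebra_simps)
  qed
  have V: "f k + a * C * G k \<le> e ^ k * (f 0 + a * C * G 0) + (1 - e ^ k) / \<mu> * C * \<theta>"
    if "k < K" for k
    using that
  proof (induction k)
    case (Suc k)
    have "f (Suc k) + a * C * G (Suc k) \<le> e * (f k + a * C * G k) + a * C * \<theta>"
      using V_step[of k] Suc.prems by simp
    also have "\<dots> \<le> e * (e ^ k * (f 0 + a * C * G 0) + (1 - e ^ k) / \<mu> * C * \<theta>) + a * C * \<theta>"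
      using Suc e by (intro add_right_mono mult_left_mono) auto
    \<comment> \<open>Since \<open>a = (1 - e) / \<mu>\<close>, the geometric sum a (1 + e + ... +
      e^k) telescopes to (1 - e^(k+1)) / \<mu>.\<close>
    also have "\<dots> = e ^ Suc k * (f 0 + a * C * G 0) + (1 - e ^ Suc k) / \<mu> * C * \<theta>"
      using \<mu> by (simp add: a_def field_simps)
    finally show ?case .
  qed simp
  obtain n where n: "K = n + 1" using \<open>1 \<le> K\<close> by (metis add.commute le_add_diff_inverse)
  \<comment> \<open>No recursion is available for an error at index \<open>K\<close>, so only the
    descent bound is used. Then 1 \<le> C e restores the Lyapunov function at \<open>n\<close>, and
    adding the nonnegative \<open>a * C * \<theta>\<close> gives the last step the shape of the
    earlier ones.\<close>
  have "f K \<le> e * f n + a * G n"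
  proof -
    have "0 \<le> a / 4 * N n" using a N0[of n] by simp
    moreover have "f K + a / 4 * N n \<le> e * f n + a * G n" using f_step[of n] n by simp
    ultimately show ?thesis by linarith
  qed
  also have "\<dots> \<le> e * f n + a * (C * e) * G n"
    using mult_right_mono[OF mult_left_mono[OF bounds(2), of a] G0[of n]] a by (simp add: e_def)
  also have "\<dots> \<le> e * (f n + a * C * G n) + a * C * \<theta>"
    using a C0 p by (simp add: algebra_simps)
  also have "\<dots> \<le> e * (e ^ n * (f 0 + a * C * G 0) + (1 - e ^ n) / \<mu> * C * \<theta>) + a * C * \<theta>"
    using V[of n] n e by (intro add_right_mono mult_left_mono) auto
  also have "\<dots> = e ^ K * (f 0 + a * C * G 0) + (1 - e ^ K) / \<mu> * C * \<theta>"
    using \<mu> n by (simp add: a_def field_simps)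
  finally have "f K \<le> e ^ K * (f 0 + a * C * G 0) + (1 - e ^ K) / \<mu> * C * \<theta>" .
  moreover have "e ^ K = exp (- \<mu> * real K * h)" "e ^ K = exp (- real K * \<mu> * h)"
    by (simp_all add: e_def exp_of_nat_mult[symmetric] mult_ac)
  moreover have "f 0 + a * C * G 0 = \<Psi>\<^sub>2 - F xstar"
    by (simp add: f0(2) assms(14) a_def e_def G_def)
  ultimately have "f K \<le> exp (- \<mu> * real K * h) * (\<Psi>\<^sub>2 - F xstar)
      + (1 - exp (- real K * \<mu> * h)) / \<mu> * C * \<theta>"
    by metis
  then show ?thesis using F_int[of K] unfolding f_def by blast
qed

end
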